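(* Let $M$ and $N$ be two means with Seiffert functions $m$ and $n$, respectively, and put $\widehat m(z)=m(z)/z$, $\widehat n(z)=n(z)/z$ for $z\in(0,1)$. Suppose that $\widehat n(z)$ is strictly monotone and let $$p_0=\inf_{z}\frac{\widehat n^{-1}(\widehat m(z))}{z},\qquad q_0=\sup_{z}\frac{\widehat n^{-1}(\widehat m(z))}{z},$$ where $z$ ranges over $(0,1)$ and $\widehat n^{-1}$ is the inverse function of $\widehat n$. (1) If $A(x,y)<M(x,y)<N(x,y)$ for all $x\neq y$, then the inequalities $N_p(x,y)\leqslant M(x,y)\leqslant N_q(x,y)$ hold if and only if $p\leqslant p_0$ and $q\geqslant q_0$. (2) If $N(x,y)<M(x,y)<A(x,y)$ for all $x\neq y$, then the inequalities $N_q(x,y)\leqslant M(x,y)\leqslant N_p(x,y)$ hold if and only if $p\leqslant p_0$ and $q\geqslant q_0$.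
   Context: $\mathbb{R}_+=(0,\infty)$. A mean is a function $M:\mathbb{R}_+^2\to\mathbb{R}$ that is symmetric, positively homogeneous of order $1$ ($M(\lambda x,\lambda y)=\lambda M(x,y)$ for all $\lambda>0$), and satisfies $\min(x,y)\leqslant M(x,y)\leqslant\max(x,y)$. The Seiffert function of a mean $M$ is $f_M(z)=\frac{z}{M(1+z,1-z)}$, $z\in(0,1)$; thus $m=f_M$ and $n=f_N$. $A(x,y)=\frac{x+y}{2}$ is the arithmetic mean. For a mean $N$ and a parameter $t\in(0,1]$, $N_t(x,y)=N\left(\frac{x+y}{2}-t\frac{x-y}{2},\frac{x+y}{2}+t\frac{x-y}{2}\right)$, so that $N_1=N$; $N_p$ and $N_q$ are these means with parameters $t=p$ and $t=q$. The inequalities between means are understood for all $x,y>0$. *)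

theory Defs
  imports Complex_Main
begin

text \<open>A mean is only meaningful on pairs of positive reals; its values elsewhere are irrelevant.\<close>

definition is_mean :: "(real \<Rightarrow> real \<Rightarrow> real) \<Rightarrow> bool" where
  "is_mean M \<longleftrightarrow>
     (\<forall>x>0. \<forall>y>0. M x y = M y x) \<and>
     (\<forall>c>0. \<forall>x>0. \<forall>y>0. M (c * x) (c * y) = c * M x y) \<and>
     (\<forall>x>0. \<forall>y>0. min x y \<le> M x y \<and> M x y \<le> max x y)"

definition arith_mean :: "real \<Rightarrow> real \<Rightarrow> real" where
  "arith_mean x y = (x + y) / 2"

text \<open>Seiffert functions are only considered on the open unit interval.\<close>

definition seiffert :: "(real \<Rightarrow> real \<Rightarrow> real) \<Rightarrow> real \<Rightarrow> real" where
  "seiffert M z = z / M (1 + z) (1 - z)"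

definition hat :: "(real \<Rightarrow> real) \<Rightarrow> real \<Rightarrow> real" where
  "hat f z = f z / z"

definition param_mean :: "(real \<Rightarrow> real \<Rightarrow> real) \<Rightarrow> real \<Rightarrow> real \<Rightarrow> real \<Rightarrow> real" where
  "param_mean N t x y = N ((x + y) / 2 - t * ((x - y) / 2)) ((x + y) / 2 + t * ((x - y) / 2))"

end

theory Submission
  imports Defs
begin

text \<open>
  By homogeneity and symmetry a mean is determined by its values at \<^term>\<open>(1 + z, 1 - z)\<close>
  for \<^term>\<open>z \<in> {0<..<1}\<close>, and there it is the reciprocal of its hatted Seiffert function.
  Passing from \<open>N\<close> to \<open>N\<^sub>t\<close> replaces \<open>z\<close> by \<open>t z\<close>, so an inequality between \<open>N\<^sub>t\<close> and \<open>M\<close> is a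
  pointwise inequality between the hatted functions at \<open>t z\<close> and \<open>z\<close>
  (\<open>param_mean_le_iff\<close>).

  Write the value of the hatted \<open>m\<close> at \<open>z\<close> as the hatted \<open>n\<close> at a point \<open>w z\<close>. Strict monotonicity
  strips the function off both sides: the inequality becomes \<open>p z \<le> w z\<close> or \<open>w z \<le> q z\<close>, that
  is, \<open>p\<close> is a lower bound or \<open>q\<close> an upper bound of the ratios \<open>w z / z\<close>
  (\<open>le_Inf_ratio_iff\<close>, \<open>Sup_ratio_le_iff\<close>). The strict inequality between \<open>M\<close> and \<open>N\<close> gives
  \<open>w z < z\<close>, so that the ratios are bounded and their supremum is meaningful.

  The direction of the monotonicity is dictated by the position of \<open>N\<close> relative to the arithmetic
  mean, whose hatted Seiffert function is the constant 1: every hatted function tends to 1 at 0,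
  so an increasing one stays above 1 and a decreasing one below 1
  (\<open>hat_seiffert_ge_1\<close>, \<open>hat_seiffert_le_1\<close>).
\<close>

section \<open>Means on the normalised pairs\<close>

lemma is_mean_bounds:
  assumes "is_mean M" "x > 0" "y > 0"
  shows "min x y \<le> M x y" "M x y \<le> max x y" "0 < M x y"
proof -
  show *: "min x y \<le> M x y" "M x y \<le> max x y"
    using assms unfolding is_mean_def by blast+
  have "0 < min x y" using assms by simp
  with * show "0 < M x y" by linarith
qed

lemma is_mean_sym: "is_mean M \<Longrightarrow> x > 0 \<Longrightarrow> y > 0 \<Longrightarrow> M x y = M y x"
  unfolding is_mean_def by blast

lemma mult_in_unit_interval:
  fixes t z :: real
  assumes "0 < t" "t \<le> 1" "0 < z" "z < 1"
  shows "0 < t * z" "t * z < 1"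
proof -
  have "t * z \<le> 1 * z" using assms by (intro mult_right_mono) auto
  with assms(4) show "t * z < 1" by linarith
  show "0 < t * z" using assms by simp
qed

lemma hat_seiffert: "z \<noteq> 0 \<Longrightarrow> hat (seiffert M) z = 1 / M (1 + z) (1 - z)"
  by (simp add: hat_def seiffert_def)

lemma param_mean_diag:
  assumes "is_mean N" "x > 0"
  shows "param_mean N t x x = x"
  using is_mean_bounds[of N x x] assms by (simp add: param_mean_def)

lemma param_mean_1:
  assumes "is_mean N" "x > 0" "y > 0"
  shows "param_mean N 1 x y = N x y"
proof -
  have "(x + y) / 2 - 1 * ((x - y) / 2) = y" "(x + y) / 2 + 1 * ((x - y) / 2) = x"
    by (simp_all add: field_simps)
  then have "param_mean N 1 x y = N y x"
    unfolding param_mean_def by presburger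
  then show ?thesis
    using is_mean_sym assms by simp
qed

text \<open>
  The pair \<^term>\<open>(x, y)\<close> is \<^term>\<open>(x + y) / 2\<close> times
  \<open>(1 \<plusminus> z, 1 \<minusplus> z)\<close>, and symmetry of the mean removes the dependence on the sign.
\<close>

lemma param_mean_eq_hat_seiffert:
  assumes N: "is_mean N" and xy: "x > 0" "y > 0" "x \<noteq> y" and t: "0 < t" "t \<le> 1"
  defines "z \<equiv> \<bar>x - y\<bar> / (x + y)"
  shows "param_mean N t x y = (x + y) / 2 / hat (seiffert N) (t * z)"
proof -
  define s where "s = (x + y) / 2"
  have s: "s > 0" using xy by (simp add: s_def)
  have z: "0 < z" "z < 1" using xy by (auto simp: z_def field_simps)
  note tz = mult_in_unit_interval[OF t z]
  have half: "\<bar>x - y\<bar> / 2 = s * z" using xy by (simp add: s_def z_def field_simps)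
  have scale: "N (s * (1 + t * z)) (s * (1 - t * z)) = s * N (1 + t * z) (1 - t * z)"
    using N s tz unfolding is_mean_def by force
  have sym: "N (s * (1 - t * z)) (s * (1 + t * z)) = N (s * (1 + t * z)) (s * (1 - t * z))"
    using N s tz by (intro is_mean_sym) auto
  have "param_mean N t x y = N (s * (1 + t * z)) (s * (1 - t * z))"
  proof (cases "y < x")
    case True
    then have d: "(x - y) / 2 = s * z" using half by simp
    then have "param_mean N t x y = N (s * (1 - t * z)) (s * (1 + t * z))"
      unfolding param_mean_def s_def[symmetric] d by (simp add: algebra_simps)
    with sym show ?thesis by simp
  next
    case False
    then have d: "(x - y) / 2 = - (s * z)" using half by (auto simp: abs_if not_less split: if_splits)
    then show ?thesis
      unfolding param_mean_def s_def[symmetric] d by (simp add: algebra_simps)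
  qed
  then show ?thesis
    using scale hat_seiffert[OF less_imp_neq[OF tz(1), symmetric], of N]
    unfolding s_def[symmetric] by simp
qed

lemma hat_seiffert_pos:
  assumes "is_mean N" "0 < z" "z < 1"
  shows "0 < hat (seiffert N) z"
  using is_mean_bounds(3)[of N "1 + z" "1 - z"] assms by (simp add: hat_seiffert)

text \<open>
  Both sides scale by the same factor \<^term>\<open>(x + y) / 2\<close>, and every \<^term>\<open>z \<in> {0<..<1}\<close> occurs for
  the pair \<^term>\<open>(1 + z, 1 - z)\<close>. Taking one parameter to be 1 compares
  \<open>N\<^sub>t\<close> with \<open>M\<close>, in either direction.
\<close>

lemma param_mean_le_iff:
  assumes N: "is_mean N" and M: "is_mean M" and s: "0 < s" "s \<le> 1" and t: "0 < t" "t \<le> 1"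
  shows "(\<forall>x>0. \<forall>y>0. param_mean N s x y \<le> param_mean M t x y) \<longleftrightarrow>
    (\<forall>z\<in>{0<..<1}. hat (seiffert M) (t * z) \<le> hat (seiffert N) (s * z))"
    (is "?means \<longleftrightarrow> ?hats")
proof -
  have pair: "param_mean N s x y \<le> param_mean M t x y \<longleftrightarrow>
      hat (seiffert M) (t * z) \<le> hat (seiffert N) (s * z)"
    if xy: "x > 0" "y > 0" "x \<noteq> y" and z_def: "z = \<bar>x - y\<bar> / (x + y)" for x y z
  proof -
    have z: "0 < z" "z < 1" using xy by (auto simp: z_def field_simps)
    have "0 < hat (seiffert N) (s * z)" "0 < hat (seiffert M) (t * z)"
      using mult_in_unit_interval[OF s z] mult_in_unit_interval[OF t z]
      by (auto intro!: hat_seiffert_pos N M)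
    moreover have "0 < (x + y) / 2" using xy by simp
    moreover have "c / a \<le> c / b \<longleftrightarrow> b \<le> a" if "0 < a" "0 < b" "0 < c" for a b c :: real
      using that by (simp add: field_simps)
    ultimately show ?thesis
      unfolding param_mean_eq_hat_seiffert[OF N xy s] param_mean_eq_hat_seiffert[OF M xy t]
        z_def[symmetric]
      by blast
  qed
  show ?thesis
  proof
    assume L: ?means
    show ?hats
    proof
      fix z :: real assume z: "z \<in> {0<..<1}"
      then have "z = \<bar>(1 + z) - (1 - z)\<bar> / ((1 + z) + (1 - z))" by simp
      from pair[OF _ _ _ this] L z
      show "hat (seiffert M) (t * z) \<le> hat (seiffert N) (s * z)" by auto
    qed
  next
    assume R: ?hats
    show ?means
    proof (intro allI impI)
      fix x y :: real assume xy: "x > 0" "y > 0"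
      show "param_mean N s x y \<le> param_mean M t x y"
      proof (cases "x = y")
        case True
        then show ?thesis using param_mean_diag N M xy by simp
      next
        case False
        with xy have "\<bar>x - y\<bar> / (x + y) \<in> {0<..<1}" by (auto simp: field_simps)
        with R pair[OF xy False refl] show ?thesis by blast
      qed
    qed
  qed
qed

lemma hat_seiffert_less_if_mean_less:
  assumes "is_mean M" and "\<forall>x>0. \<forall>y>0. x \<noteq> y \<longrightarrow> M x y < N x y" and "z \<in> {0<..<1}"
  shows "hat (seiffert N) z < hat (seiffert M) z"
proof -
  have "M (1 + z) (1 - z) < N (1 + z) (1 - z)" "0 < M (1 + z) (1 - z)"
    using assms is_mean_bounds(3)[of M "1 + z" "1 - z"] by auto
  then show ?thesis using assms(3) by (simp add: hat_seiffert frac_less2)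
qed

section \<open>The direction of monotonicity\<close>

text \<open>
  An increasing hatted function means that the mean decreases in \<open>z\<close>. Were \<^term>\<open>N (1 + z) (1 - z) = g\<close>
  with \<^term>\<open>g > 1\<close>, then at \<^term>\<open>(g - 1) / 2\<close>, which lies to the left of \<open>z\<close>, the mean would still
  have to exceed \<open>g\<close>, but the upper bound there is only \<^term>\<open>(g + 1) / 2\<close>.
\<close>

lemma hat_seiffert_ge_1:
  assumes N: "is_mean N" and mono: "strict_mono_on {0<..<1} (hat (seiffert N))"
    and z: "z \<in> {0<..<1}"
  shows "1 \<le> hat (seiffert N) z"
proof (rule ccontr)
  assume less: "\<not> 1 \<le> hat (seiffert N) z"
  define g where "g = N (1 + z) (1 - z)"
  define u where "u = (g - 1) / 2"
  have g: "0 < g" "g \<le> 1 + z"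
    using is_mean_bounds[OF N, of "1 + z" "1 - z"] z by (auto simp: g_def)
  have "1 < g" using less z g(1) by (simp add: hat_seiffert flip: g_def)
  then have u: "0 < u" "u < z" "1 + u < g" using g z by (auto simp: u_def field_simps)
  have b: "0 < N (1 + u) (1 - u)" "N (1 + u) (1 - u) \<le> 1 + u"
    using is_mean_bounds[OF N, of "1 + u" "1 - u"] u z by auto
  have "hat (seiffert N) u < hat (seiffert N) z"
    using mono u z by (auto simp: monotone_on_def)
  then have "g < N (1 + u) (1 - u)"
    using b g u z by (simp add: hat_seiffert field_simps flip: g_def)
  with b u show False by linarith
qed

lemma hat_seiffert_le_1:
  assumes N: "is_mean N" and anti: "strict_antimono_on {0<..<1} (hat (seiffert N))"
    and z: "z \<in> {0<..<1}"
  shows "hat (seiffert N) z \<le> 1"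
proof (rule ccontr)
  assume less: "\<not> hat (seiffert N) z \<le> 1"
  define g where "g = N (1 + z) (1 - z)"
  define u where "u = (1 - g) / 2"
  have g: "0 < g" "1 - z \<le> g"
    using is_mean_bounds[OF N, of "1 + z" "1 - z"] z by (auto simp: g_def)
  have "g < 1" using less z g(1) by (simp add: hat_seiffert flip: g_def)
  then have u: "0 < u" "u < z" "g < 1 - u" using g z by (auto simp: u_def field_simps)
  have b: "0 < N (1 + u) (1 - u)" "1 - u \<le> N (1 + u) (1 - u)"
    using is_mean_bounds[OF N, of "1 + u" "1 - u"] u z by auto
  have "hat (seiffert N) z < hat (seiffert N) u"
    using anti u z by (auto simp: monotone_on_def)
  then have "N (1 + u) (1 - u) < g"
    using b g u z by (simp add: hat_seiffert field_simps flip: g_def)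
  with b u show False by linarith
qed

section \<open>Optimal constants for an increasing function\<close>

text \<open>
  Since \<^term>\<open>k z = h (w z)\<close> for the preimage \<open>w z\<close>, strict monotonicity turns any comparison of
  \<open>h\<close> with \<open>k\<close> into one of the argument with \<open>w z\<close>; dividing by \<open>z\<close> gives the ratio.
\<close>

lemma compare_preimage_ratio:
  fixes h k :: "real \<Rightarrow> real"
  assumes mono: "strict_mono_on {0<..<1} h"
    and img: "k ` {0<..<1} \<subseteq> h ` {0<..<1}"
    and z: "z \<in> {0<..<1}" and t: "0 < t" "t \<le> 1"
  shows "h (t * z) \<le> k z \<longleftrightarrow> t \<le> inv_into {0<..<1} h (k z) / z"
    and "k z \<le> h (t * z) \<longleftrightarrow> inv_into {0<..<1} h (k z) / z \<le> t"
    and "0 < inv_into {0<..<1} h (k z) / z"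
proof -
  define w where "w = inv_into {0<..<1} h (k z)"
  have "k z \<in> h ` {0<..<1}" using img z by blast
  then have w: "w \<in> {0<..<1}" "h w = k z"
    unfolding w_def by (rule inv_into_into, rule f_inv_into_f)
  have tz: "t * z \<in> {0<..<1}" using mult_in_unit_interval[of t z] t z by simp
  have "h (t * z) \<le> h w \<longleftrightarrow> t * z \<le> w" "h w \<le> h (t * z) \<longleftrightarrow> w \<le> t * z"
    using strict_mono_on_leD[OF mono] strict_mono_onD[OF mono] tz w(1)
    by (meson linorder_not_le)+
  then show "h (t * z) \<le> k z \<longleftrightarrow> t \<le> inv_into {0<..<1} h (k z) / z"
    and "k z \<le> h (t * z) \<longleftrightarrow> inv_into {0<..<1} h (k z) / z \<le> t"
    and "0 < inv_into {0<..<1} h (k z) / z"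
    using w z by (simp_all add: field_simps flip: w_def)
qed

lemma le_Inf_ratio_iff:
  fixes h k :: "real \<Rightarrow> real"
  assumes "strict_mono_on {0<..<1} h" "k ` {0<..<1} \<subseteq> h ` {0<..<1}" and p: "0 < p" "p \<le> 1"
  shows "p \<le> (INF z\<in>{0<..<1}. inv_into {0<..<1} h (k z) / z) \<longleftrightarrow>
    (\<forall>z\<in>{0<..<1}. h (p * z) \<le> k z)"
proof -
  note ratio = compare_preimage_ratio[OF assms(1,2) _ p]
  have "bdd_below ((\<lambda>z. inv_into {0<..<1} h (k z) / z) ` {0<..<1})"
    using ratio(3) by (intro bdd_belowI2[of _ 0] less_imp_le)
  then show ?thesis
    by (subst le_cINF_iff) (simp_all add: ratio(1))
qed

text \<open>
  The hypothesis that \<open>k\<close> lies below \<open>h\<close> bounds the ratios by 1.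
\<close>

lemma Sup_ratio_le_iff:
  fixes h k :: "real \<Rightarrow> real"
  assumes "strict_mono_on {0<..<1} h" "k ` {0<..<1} \<subseteq> h ` {0<..<1}" and q: "0 < q" "q \<le> 1"
    and below: "\<And>z. z \<in> {0<..<1} \<Longrightarrow> k z < h z"
  shows "(SUP z\<in>{0<..<1}. inv_into {0<..<1} h (k z) / z) \<le> q \<longleftrightarrow>
    (\<forall>z\<in>{0<..<1}. k z \<le> h (q * z))"
proof -
  have "inv_into {0<..<1} h (k z) / z \<le> 1" if z: "z \<in> {0<..<1}" for z
    using compare_preimage_ratio(2)[OF assms(1,2) z, of 1] below[OF z] by simp
  then have "bdd_above ((\<lambda>z. inv_into {0<..<1} h (k z) / z) ` {0<..<1})"
    by (rule bdd_aboveI2)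
  then show ?thesis
    by (subst cSUP_le_iff)
      (simp_all add: compare_preimage_ratio(2)[OF assms(1,2) _ q])
qed

section \<open>Optimal parameters\<close>

lemma inv_into_uminus:
  fixes h :: "'a \<Rightarrow> 'b::group_add"
  shows "inv_into A (\<lambda>x. - h x) (- c) = inv_into A h c"
  by (simp add: inv_into_def)

theorem theorem7p1:
  fixes M N :: "real \<Rightarrow> real \<Rightarrow> real" and m n :: "real \<Rightarrow> real" and p0 q0 :: real
  assumes "is_mean M" and "is_mean N"
    and "m = seiffert M" and "n = seiffert N"
    and "strict_mono_on {0<..<1} (hat n) \<or> strict_antimono_on {0<..<1} (hat n)"
    and "hat m ` {0<..<1} \<subseteq> hat n ` {0<..<1}"
    and "p0 = (INF z\<in>{0<..<1}. inv_into {0<..<1} (hat n) (hat m z) / z)"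
    and "q0 = (SUP z\<in>{0<..<1}. inv_into {0<..<1} (hat n) (hat m z) / z)"
  shows
    "((\<forall>x>0. \<forall>y>0. x \<noteq> y \<longrightarrow> arith_mean x y < M x y \<and> M x y < N x y) \<longrightarrow>
       (\<forall>p\<in>{0<..1}. \<forall>q\<in>{0<..1}.
          (\<forall>x>0. \<forall>y>0. param_mean N p x y \<le> M x y \<and> M x y \<le> param_mean N q x y)
          \<longleftrightarrow> p \<le> p0 \<and> q \<ge> q0)) \<and>
     ((\<forall>x>0. \<forall>y>0. x \<noteq> y \<longrightarrow> N x y < M x y \<and> M x y < arith_mean x y) \<longrightarrow>
       (\<forall>p\<in>{0<..1}. \<forall>q\<in>{0<..1}.
          (\<forall>x>0. \<forall>y>0. param_mean N q x y \<le> M x y \<and> M x y \<le> param_mean N p x y)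
          \<longleftrightarrow> p \<le> p0 \<and> q \<ge> q0))"
proof -
  let ?I = "{0<..<1} :: real set"
  note M = assms(1) and N = assms(2) and mono = assms(5) and img = assms(6)
  note m = assms(3) and n = assms(4) and p0 = assms(7) and q0 = assms(8)
  have lower: "(\<forall>x>0. \<forall>y>0. param_mean N t x y \<le> M x y) \<longleftrightarrow>
      (\<forall>z\<in>?I. hat m z \<le> hat n (t * z))"
    and upper: "(\<forall>x>0. \<forall>y>0. M x y \<le> param_mean N t x y) \<longleftrightarrow>
      (\<forall>z\<in>?I. hat n (t * z) \<le> hat m z)"
    if "t \<in> {0<..1}" for t
    using param_mean_le_iff[OF N M, of t 1] param_mean_le_iff[OF M N, of 1 t] that
    by (simp_all add: param_mean_1 M N m n)
  have decreasing: "(\<forall>x>0. \<forall>y>0. param_mean N p x y \<le> M x y \<and> M x y \<le> param_mean N q x y)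
      \<longleftrightarrow> p \<le> p0 \<and> q \<ge> q0"
    if less: "\<forall>x>0. \<forall>y>0. x \<noteq> y \<longrightarrow> arith_mean x y < M x y \<and> M x y < N x y"
      and p: "p \<in> {0<..1}" and q: "q \<in> {0<..1}" for p q
  proof -
    have side: "hat n z < 1" if z: "z \<in> ?I" for z
    proof -
      have "arith_mean (1 + z) (1 - z) < N (1 + z) (1 - z)"
        using less[rule_format, of "1 + z" "1 - z"] z by simp
      then show ?thesis using z by (simp add: arith_mean_def n hat_seiffert)
    qed
    have "\<not> strict_mono_on ?I (hat n)"
      using hat_seiffert_ge_1[OF N, of "1/2"] side[of "1/2"] by (auto simp: n)
    with mono have anti: "strict_antimono_on ?I (hat n)" by blast
    \<comment> \<open>Negating both functions reduces to the increasing case and leaves the preimages as they are.\<close>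
    let ?h = "\<lambda>z. - hat n z" and ?k = "\<lambda>z. - hat m z"
    have inc: "strict_mono_on ?I ?h" using anti by (auto simp: monotone_on_def)
    have img': "?k ` ?I \<subseteq> ?h ` ?I" using image_mono[OF img, of uminus] by (simp add: image_image)
    have below: "?k z < ?h z" if "z \<in> ?I" for z
      using hat_seiffert_less_if_mean_less[OF M _ that, of N] less by (simp add: m n)
    have "p \<le> p0 \<longleftrightarrow> (\<forall>z\<in>?I. hat m z \<le> hat n (p * z))"
      using le_Inf_ratio_iff[OF inc img', of p] p by (simp add: p0 inv_into_uminus)
    moreover have "q0 \<le> q \<longleftrightarrow> (\<forall>z\<in>?I. hat n (q * z) \<le> hat m z)"
      using Sup_ratio_le_iff[OF inc img' _ _ below, of q] q by (simp add: q0 inv_into_uminus)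
    ultimately show ?thesis using lower[OF p] upper[OF q] by blast
  qed
  have increasing: "(\<forall>x>0. \<forall>y>0. param_mean N q x y \<le> M x y \<and> M x y \<le> param_mean N p x y)
      \<longleftrightarrow> p \<le> p0 \<and> q \<ge> q0"
    if less: "\<forall>x>0. \<forall>y>0. x \<noteq> y \<longrightarrow> N x y < M x y \<and> M x y < arith_mean x y"
      and p: "p \<in> {0<..1}" and q: "q \<in> {0<..1}" for p q
  proof -
    have side: "1 < hat n z" if z: "z \<in> ?I" for z
    proof -
      have "N (1 + z) (1 - z) < arith_mean (1 + z) (1 - z)"
        using less[rule_format, of "1 + z" "1 - z"] z by simp
      then show ?thesis
        using z is_mean_bounds(3)[OF N, of "1 + z" "1 - z"]
        by (simp add: arith_mean_def n hat_seiffert)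
    qed
    have "\<not> strict_antimono_on ?I (hat n)"
      using hat_seiffert_le_1[OF N, of "1/2"] side[of "1/2"] by (auto simp: n)
    with mono have inc: "strict_mono_on ?I (hat n)" by blast
    have below: "hat m z < hat n z" if "z \<in> ?I" for z
      using hat_seiffert_less_if_mean_less[OF N _ that, of M] less by (simp add: m n)
    have "p \<le> p0 \<longleftrightarrow> (\<forall>z\<in>?I. hat n (p * z) \<le> hat m z)"
      using le_Inf_ratio_iff[OF inc img, of p] p by (simp add: p0)
    moreover have "q0 \<le> q \<longleftrightarrow> (\<forall>z\<in>?I. hat m z \<le> hat n (q * z))"
      using Sup_ratio_le_iff[OF inc img _ _ below, of q] q by (simp add: q0)
    ultimately show ?thesis using lower[OF q] upper[OF p] by blast
  qed
  show ?thesis using decreasing increasing by blast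
qed

end
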